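(* Let $\Gamma_2=(V,L)$ be the Cayley tree of order two with root $x^0$, let $\xi_1:[0,1]^3\to\mathbb{R}$ and $\xi_2,\xi_3:[0,1]^2\to\mathbb{R}$ be bounded measurable functions, let $\beta>0$ and $J,J_1,J_3,\alpha\in\mathbb{R}$ with $J_3^2+J_1^2+J^2+\alpha^2\neq 0$, and let $h:[0,1]\times (V\setminus\{x^0\})\to\mathbb{R}$, $(t,x)\mapsto h_{t,x}$, be a function that is measurable in $t$ and bounded in $t$ for each $x$. Put $f(t,x)=\exp(h_{t,x}-h_{0,x})$ and $$K(t,u,v)=\exp\left\{J_3\beta\,\xi_1(t,u,v)+J\beta\,\xi_2(u,v)+J_1\beta\left(\xi_3(t,u)+\xi_3(t,v)\right)+\alpha\beta(u+v)\right\}.$$ Let $\mu^{(n)}$, $n\ge 1$, be the probability densities on $[0,1]^{V_n}$ defined by the Hamiltonian and $h$ (see context). Then the densities $\mu^{(n)}$ satisfy the consistency condition $$\int_{[0,1]^{W_n}}\mu^{(n)}(\sigma_{n-1}\vee\omega_n)\,\lambda_{W_n}(d\omega_n)=\mu^{(n-1)}(\sigma_{n-1})\quad\text{for all } n\ge 2 \text{ and all } \sigma_{n-1}\in[0,1]^{V_{n-1}}$$ if and only if for every $x\in V\setminus\{x^0\}$, with $S(x)=\{y,z\}$ (listed in the fixed order), and every $t\in[0,1]$, $$f(t,x)=\frac{\int_0^1\int_0^1K(t,u,v)f(u,y)f(v,z)\,du\,dv}{\int_0^1\int_0^1K(0,u,v)f(u,y)f(v,z)\,du\,dv}.$$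
   Context: The Cayley tree $\Gamma_2=(V,L)$ of order two is the infinite tree in which every vertex has exactly 3 neighbours. Fix a root $x^0\in V$; $d$ is the graph distance, $W_n=\{x\in V: d(x,x^0)=n\}$, $V_n=\{x\in V: d(x,x^0)\le n\}$. For $x\in W_n$, $S(x)=\{y\in W_{n+1}: d(x,y)=1\}$ is the set of direct successors of $x$ (3 successors for the root, 2 for every other vertex). For each $x$ fix a linear order $<$ on $S(x)$; it determines the order in which successors appear as arguments of $\xi_1,\xi_2$ and $K$. For $\sigma\in[0,1]^{V_n}$, $n\ge1$, the Hamiltonian on $V_n$ is $$H(\sigma)=-J_3\sum_{x\in V_{n-1}}\ \sum_{y<z,\ y,z\in S(x)}\xi_1(\sigma(x),\sigma(y),\sigma(z))-J\sum_{x\in V_{n-1}}\ \sum_{y<z,\ y,z\in S(x)}\xi_2(\sigma(y),\sigma(z))$$ $$-J_1\sum_{x\in V_{n-1}}\sum_{y\in S(x)}\xi_3(\sigma(x),\sigma(y))-\alpha\sum_{x\in V_n}\sigma(x)$$ (triples of neighbours: a vertex with two of its direct successors; second neighbours: two direct successors of a common vertex; nearest neighbours; external field). For a finite set $\Lambda\subset V$, $\lambda_\Lambda$ is the product Lebesgue measure on $[0,1]^\Lambda$. For $n\ge1$, $\mu^{(n)}$ is the probability density with respect to $\lambda_{V_n}$ on $[0,1]^{V_n}$ given by $$\mu^{(n)}(\sigma_n)=Z_n^{-1}\exp\Big(-\beta H(\sigma_n)+\sum_{x\in W_n}h_{\sigma_n(x),x}\Big),$$ where $Z_n$ is the normalizing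 constant. For $\sigma_{n-1}\in[0,1]^{V_{n-1}}$ and $\omega_n\in[0,1]^{W_n}$, $\sigma_{n-1}\vee\omega_n\in[0,1]^{V_n}$ denotes their concatenation. *)

theory Defs
  imports "HOL-Analysis.Analysis"
begin

section \<open>Simple graphs, trees and the Cayley tree\<close>

definition simple_graph :: "'v set \<Rightarrow> 'v set set \<Rightarrow> bool" where
  "simple_graph V L \<longleftrightarrow> (\<forall>e\<in>L. e \<subseteq> V \<and> card e = 2)"

definition walk :: "'v set \<Rightarrow> 'v set set \<Rightarrow> 'v list \<Rightarrow> bool" where
  "walk V L xs \<longleftrightarrow> xs \<noteq> [] \<and> set xs \<subseteq> V \<and> successively (\<lambda>x y. {x, y} \<in> L) xs"

definition walk_betw :: "'v set \<Rightarrow> 'v set set \<Rightarrow> 'v \<Rightarrow> 'v list \<Rightarrow> 'v \<Rightarrow> bool" where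
  "walk_betw V L x xs y \<longleftrightarrow> walk V L xs \<and> hd xs = x \<and> last xs = y"

definition connected_graph :: "'v set \<Rightarrow> 'v set set \<Rightarrow> bool" where
  "connected_graph V L \<longleftrightarrow> V \<noteq> {} \<and> (\<forall>x\<in>V. \<forall>y\<in>V. \<exists>xs. walk_betw V L x xs y)"

text \<open>The vertices of a cycle are listed once each; the closing edge joins the last to the first.\<close>
definition graph_cycle :: "'v set \<Rightarrow> 'v set set \<Rightarrow> 'v list \<Rightarrow> bool" where
  "graph_cycle V L xs \<longleftrightarrow> walk V L xs \<and> distinct xs \<and> length xs \<ge> 3 \<and> {last xs, hd xs} \<in> L"

definition tree :: "'v set \<Rightarrow> 'v set set \<Rightarrow> bool" where
  "tree V L \<longleftrightarrow> simple_graph V L \<and> connected_graph V L \<and> \<not> (\<exists>xs. graph_cycle V L xs)"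

definition neighbours :: "'v set \<Rightarrow> 'v set set \<Rightarrow> 'v \<Rightarrow> 'v set" where
  "neighbours V L x = {y\<in>V. {x, y} \<in> L}"

definition cayley_tree :: "nat \<Rightarrow> 'v set \<Rightarrow> 'v set set \<Rightarrow> bool" where
  "cayley_tree k V L \<longleftrightarrow> tree V L \<and> infinite V \<and> (\<forall>x\<in>V. card (neighbours V L x) = k + 1)"

text \<open>A walk along \<open>m\<close> edges is a list of \<open>m + 1\<close> vertices.\<close>
definition gdist :: "'v set \<Rightarrow> 'v set set \<Rightarrow> 'v \<Rightarrow> 'v \<Rightarrow> nat" where
  "gdist V L x y = (LEAST m. \<exists>xs. walk_betw V L x xs y \<and> length xs = m + 1)"

definition sphere_at :: "'v set \<Rightarrow> 'v set set \<Rightarrow> 'v \<Rightarrow> nat \<Rightarrow> 'v set" where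
  "sphere_at V L x0 n = {x\<in>V. gdist V L x x0 = n}"

definition ball_at :: "'v set \<Rightarrow> 'v set set \<Rightarrow> 'v \<Rightarrow> nat \<Rightarrow> 'v set" where
  "ball_at V L x0 n = {x\<in>V. gdist V L x x0 \<le> n}"

definition successors :: "'v set \<Rightarrow> 'v set set \<Rightarrow> 'v \<Rightarrow> 'v \<Rightarrow> 'v set" where
  "successors V L x0 x = {y \<in> sphere_at V L x0 (gdist V L x x0 + 1). gdist V L x y = 1}"

text \<open>\<open>prec x\<close> is the strict linear order chosen on the successors of \<open>x\<close>;
  \<open>(y, z) \<in> prec x\<close> means that \<open>y\<close> precedes \<open>z\<close>.\<close>
definition succ_pairs ::
  "'v set \<Rightarrow> 'v set set \<Rightarrow> 'v \<Rightarrow> ('v \<Rightarrow> 'v rel) \<Rightarrow> 'v \<Rightarrow> ('v \<times> 'v) set" where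
  "succ_pairs V L x0 prec x =
     {(y, z). y \<in> successors V L x0 x \<and> z \<in> successors V L x0 x \<and> (y, z) \<in> prec x}"

section \<open>The model with spins in the unit interval\<close>

text \<open>Product Lebesgue measure on \<open>[0,1]\<^sup>\<Lambda>\<close>, with the Borel sigma-algebra. Configurations are the
  elements of \<open>\<Lambda> \<rightarrow>\<^sub>E {0..1}\<close>.\<close>
definition spin_measure :: "'v set \<Rightarrow> ('v \<Rightarrow> real) measure" where
  "spin_measure \<Lambda> = (\<Pi>\<^sub>M x\<in>\<Lambda>. restrict_space lborel {0..1})"

definition hamiltonian ::
  "'v set \<Rightarrow> 'v set set \<Rightarrow> 'v \<Rightarrow> ('v \<Rightarrow> 'v rel) \<Rightarrow>
   (real \<Rightarrow> real \<Rightarrow> real \<Rightarrow> real) \<Rightarrow> (real \<Rightarrow> real \<Rightarrow> real) \<Rightarrow> (real \<Rightarrow> real \<Rightarrow> real) \<Rightarrow>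
   real \<Rightarrow> real \<Rightarrow> real \<Rightarrow> real \<Rightarrow> nat \<Rightarrow> ('v \<Rightarrow> real) \<Rightarrow> real" where
  "hamiltonian V L x0 prec \<xi>1 \<xi>2 \<xi>3 J3 J J1 \<alpha> n \<sigma> =
     - J3 * (\<Sum>x\<in>ball_at V L x0 (n - 1). \<Sum>(y, z)\<in>succ_pairs V L x0 prec x. \<xi>1 (\<sigma> x) (\<sigma> y) (\<sigma> z))
     - J * (\<Sum>x\<in>ball_at V L x0 (n - 1). \<Sum>(y, z)\<in>succ_pairs V L x0 prec x. \<xi>2 (\<sigma> y) (\<sigma> z))
     - J1 * (\<Sum>x\<in>ball_at V L x0 (n - 1). \<Sum>y\<in>successors V L x0 x. \<xi>3 (\<sigma> x) (\<sigma> y))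
     - \<alpha> * (\<Sum>x\<in>ball_at V L x0 n. \<sigma> x)"

definition gibbs_weight ::
  "'v set \<Rightarrow> 'v set set \<Rightarrow> 'v \<Rightarrow> ('v \<Rightarrow> 'v rel) \<Rightarrow>
   (real \<Rightarrow> real \<Rightarrow> real \<Rightarrow> real) \<Rightarrow> (real \<Rightarrow> real \<Rightarrow> real) \<Rightarrow> (real \<Rightarrow> real \<Rightarrow> real) \<Rightarrow>
   real \<Rightarrow> real \<Rightarrow> real \<Rightarrow> real \<Rightarrow> real \<Rightarrow> (real \<Rightarrow> 'v \<Rightarrow> real) \<Rightarrow> nat \<Rightarrow> ('v \<Rightarrow> real) \<Rightarrow> real" where
  "gibbs_weight V L x0 prec \<xi>1 \<xi>2 \<xi>3 J3 J J1 \<alpha> \<beta> h n \<sigma> =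
     exp (- \<beta> * hamiltonian V L x0 prec \<xi>1 \<xi>2 \<xi>3 J3 J J1 \<alpha> n \<sigma>
          + (\<Sum>x\<in>sphere_at V L x0 n. h (\<sigma> x) x))"

definition partition_function ::
  "'v set \<Rightarrow> 'v set set \<Rightarrow> 'v \<Rightarrow> ('v \<Rightarrow> 'v rel) \<Rightarrow>
   (real \<Rightarrow> real \<Rightarrow> real \<Rightarrow> real) \<Rightarrow> (real \<Rightarrow> real \<Rightarrow> real) \<Rightarrow> (real \<Rightarrow> real \<Rightarrow> real) \<Rightarrow>
   real \<Rightarrow> real \<Rightarrow> real \<Rightarrow> real \<Rightarrow> real \<Rightarrow> (real \<Rightarrow> 'v \<Rightarrow> real) \<Rightarrow> nat \<Rightarrow> real" where
  "partition_function V L x0 prec \<xi>1 \<xi>2 \<xi>3 J3 J J1 \<alpha> \<beta> h n =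
     (\<integral>\<sigma>. gibbs_weight V L x0 prec \<xi>1 \<xi>2 \<xi>3 J3 J J1 \<alpha> \<beta> h n \<sigma> \<partial>spin_measure (ball_at V L x0 n))"

definition gibbs_density ::
  "'v set \<Rightarrow> 'v set set \<Rightarrow> 'v \<Rightarrow> ('v \<Rightarrow> 'v rel) \<Rightarrow>
   (real \<Rightarrow> real \<Rightarrow> real \<Rightarrow> real) \<Rightarrow> (real \<Rightarrow> real \<Rightarrow> real) \<Rightarrow> (real \<Rightarrow> real \<Rightarrow> real) \<Rightarrow>
   real \<Rightarrow> real \<Rightarrow> real \<Rightarrow> real \<Rightarrow> real \<Rightarrow> (real \<Rightarrow> 'v \<Rightarrow> real) \<Rightarrow> nat \<Rightarrow> ('v \<Rightarrow> real) \<Rightarrow> real" where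
  "gibbs_density V L x0 prec \<xi>1 \<xi>2 \<xi>3 J3 J J1 \<alpha> \<beta> h n \<sigma> =
     inverse (partition_function V L x0 prec \<xi>1 \<xi>2 \<xi>3 J3 J J1 \<alpha> \<beta> h n)
       * gibbs_weight V L x0 prec \<xi>1 \<xi>2 \<xi>3 J3 J J1 \<alpha> \<beta> h n \<sigma>"

text \<open>\<open>merge\<close> is the concatenation of a configuration on the ball with one on the next sphere.\<close>
definition consistent_densities ::
  "'v set \<Rightarrow> 'v set set \<Rightarrow> 'v \<Rightarrow> (nat \<Rightarrow> ('v \<Rightarrow> real) \<Rightarrow> real) \<Rightarrow> bool" where
  "consistent_densities V L x0 \<mu> \<longleftrightarrow>
     (\<forall>n\<ge>2. \<forall>\<sigma> \<in> ball_at V L x0 (n - 1) \<rightarrow>\<^sub>E {0..1}.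
        (\<integral>\<omega>. \<mu> n (merge (ball_at V L x0 (n - 1)) (sphere_at V L x0 n) (\<sigma>, \<omega>))
           \<partial>spin_measure (sphere_at V L x0 n)) = \<mu> (n - 1) \<sigma>)"

definition field_ratio :: "(real \<Rightarrow> 'v \<Rightarrow> real) \<Rightarrow> real \<Rightarrow> 'v \<Rightarrow> real" where
  "field_ratio h t x = exp (h t x - h 0 x)"

definition interaction_kernel ::
  "(real \<Rightarrow> real \<Rightarrow> real \<Rightarrow> real) \<Rightarrow> (real \<Rightarrow> real \<Rightarrow> real) \<Rightarrow> (real \<Rightarrow> real \<Rightarrow> real) \<Rightarrow>
   real \<Rightarrow> real \<Rightarrow> real \<Rightarrow> real \<Rightarrow> real \<Rightarrow> real \<Rightarrow> real \<Rightarrow> real \<Rightarrow> real" where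
  "interaction_kernel \<xi>1 \<xi>2 \<xi>3 J3 J J1 \<alpha> \<beta> t u v =
     exp (J3 * \<beta> * \<xi>1 t u v + J * \<beta> * \<xi>2 u v + J1 * \<beta> * (\<xi>3 t u + \<xi>3 t v) + \<alpha> * \<beta> * (u + v))"

text \<open>Functions given on \<open>S\<close> are represented by total functions; only the values on \<open>S\<close> are constrained.\<close>
definition bounded_measurable_on :: "'a::topological_space set \<Rightarrow> ('a \<Rightarrow> real) \<Rightarrow> bool" where
  "bounded_measurable_on S g \<longleftrightarrow> g \<in> borel_measurable (restrict_space borel S) \<and> bounded (g ` S)"

end

theory Submission
  imports Defs "HOL-Probability.Infinite_Product_Measure"
begin

text \<open>Adding the sphere \<open>W\<^sub>n\<^sub>+\<^sub>1\<close> to \<open>V\<^sub>n\<close> multiplies the Gibbs weight by a product over \<open>x \<in> W\<^sub>n\<close> of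
  factors that depend only on the spins at \<open>x\<close> and its two successors. In a tree the successor sets
  of distinct vertices are disjoint, so integrating out \<open>W\<^sub>n\<^sub>+\<^sub>1\<close> leaves the weight on \<open>V\<^sub>n\<close> times
  \<open>\<Prod>x\<in>W\<^sub>n. c\<^sub>x(\<sigma>(x))\<close>, where \<open>c\<^sub>x\<close> is \<open>cavity x\<close>. Consistency says that this product is the constant \<open>Z\<^sub>n\<^sub>+\<^sub>1/Z\<^sub>n\<close>. Varying one
  spin at a time, this forces each \<open>c\<^sub>x\<close> to be constant, which is the integral equation for \<open>f\<close>;
  conversely, if every \<open>c\<^sub>x\<close> is constant, Fubini identifies the product as the ratio of the
  partition functions.\<close>

section \<open>Levels of a rooted tree\<close>

lemma walk_betw_append:
  assumes "walk_betw V L x xs y" "walk_betw V L y ys z"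
  shows "walk_betw V L x (xs @ tl ys) z"
proof (cases "tl ys = []")
  case True
  with assms have "ys = [y]" "y = z"
    by (cases ys; simp add: walk_betw_def walk_def)+
  with assms show ?thesis by simp
next
  case False
  with assms(2) obtain us where us: "ys = y # us" "us \<noteq> []"
    by (cases ys) (auto simp: walk_betw_def walk_def)
  with assms show ?thesis
    by (auto simp: walk_betw_def walk_def successively_append_iff successively_Cons)
qed

lemma walk_betw_rev:
  assumes "walk_betw V L x xs y" shows "walk_betw V L y (rev xs) x"
  using assms by (auto simp: walk_betw_def walk_def hd_rev last_rev insert_commute)

text \<open>Cutting out the stretch between two visits to the same vertex shortens a walk, so
  induction on the length ends at a path. The inclusion of vertex sets ensures that a vertex avoided
  by the walk stays avoided.\<close>

lemma walk_betw_distinct: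
  assumes "walk_betw V L x xs y"
  shows "\<exists>ys. walk_betw V L x ys y \<and> distinct ys \<and> set ys \<subseteq> set xs"
  using assms
proof (induction "length xs" arbitrary: xs rule: less_induct)
  case less
  show ?case
  proof (cases "distinct xs")
    case True
    then show ?thesis using less.prems by blast
  next
    case False
    then obtain as bs cs w where xs: "xs = as @ [w] @ bs @ [w] @ cs"
      using not_distinct_decomp by blast
    have "walk_betw V L x (as @ w # cs) y"
      using less.prems unfolding xs
      by (cases as)
        (auto simp: walk_betw_def walk_def successively_append_iff successively_Cons hd_append
          split: if_splits)
    from less.hyps[OF _ this] show ?thesis by (auto simp: xs)
  qed
qed

section \<open>Distance to the root, parents and successors\<close>

locale rooted_tree =
  fixes V :: "'v set" and L :: "'v set set" and x0 :: 'v
  assumes tree: "tree V L" and root: "x0 \<in> V"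
begin

abbreviation height :: "'v \<Rightarrow> nat" where "height x \<equiv> gdist V L x x0"

lemma edgeD: "{x, y} \<in> L \<Longrightarrow> x \<in> V \<and> y \<in> V \<and> x \<noteq> y"
  using tree by (fastforce simp: tree_def simple_graph_def)

lemma gdist_walk:
  assumes "x \<in> V" "y \<in> V"
  shows "\<exists>xs. walk_betw V L x xs y \<and> length xs = gdist V L x y + 1"
proof -
  from assms tree obtain xs where xs: "walk_betw V L x xs y"
    unfolding tree_def connected_graph_def by blast
  then have "length xs = (length xs - 1) + 1"
    by (cases xs) (auto simp: walk_betw_def walk_def)
  with xs have "\<exists>m xs. walk_betw V L x xs y \<and> length xs = m + 1" by blast
  then show ?thesis unfolding gdist_def by (rule LeastI_ex)
qed

lemma gdist_le: "walk_betw V L x xs y \<Longrightarrow> length xs = m + 1 \<Longrightarrow> gdist V L x y \<le> m"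
  unfolding gdist_def by (rule Least_le) blast

lemma gdist_eq_0:
  assumes "x \<in> V" "y \<in> V" shows "gdist V L x y = 0 \<longleftrightarrow> x = y"
proof
  assume "gdist V L x y = 0"
  with gdist_walk[OF assms] show "x = y"
    by (auto simp: walk_betw_def length_Suc_conv)
next
  assume "x = y"
  with gdist_le[of x "[x]" y 0] assms show "gdist V L x y = 0"
    by (auto simp: walk_betw_def walk_def)
qed

lemma gdist_eq_1:
  assumes "x \<in> V" "y \<in> V" shows "gdist V L x y = 1 \<longleftrightarrow> {x, y} \<in> L"
proof
  assume "gdist V L x y = 1"
  with gdist_walk[OF assms] show "{x, y} \<in> L"
    by (auto simp: walk_betw_def walk_def length_Suc_conv)
next
  assume e: "{x, y} \<in> L"
  then have "gdist V L x y \<le> 1"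
    using assms by (intro gdist_le[of x "[x, y]"]) (auto simp: walk_betw_def walk_def)
  moreover have "gdist V L x y \<noteq> 0" using gdist_eq_0[OF assms] edgeD[OF e] by simp
  ultimately show "gdist V L x y = 1" by simp
qed

lemma height_edge:
  assumes "{x, y} \<in> L" shows "height x \<le> height y + 1"
proof -
  have V: "x \<in> V" "y \<in> V" using edgeD[OF assms] by auto
  from gdist_walk[OF V(2) root] obtain ys
    where "walk_betw V L y ys x0" "length ys = height y + 1" by blast
  then have "walk_betw V L x (x # ys) x0" "length (x # ys) = (height y + 1) + 1"
    using V assms by (auto simp: walk_betw_def walk_def successively_Cons)
  then show ?thesis by (rule gdist_le)
qed

text \<open>The second vertex of a shortest walk to the root serves: the rest of the walk bounds its
  height above, and \<open>height_edge\<close> bounds it below.\<close>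

lemma height_parent:
  assumes "x \<in> V" "height x = Suc n"
  shows "\<exists>y. {x, y} \<in> L \<and> height y = n"
proof -
  from gdist_walk[OF assms(1) root] obtain xs
    where xs: "walk_betw V L x xs x0" "length xs = Suc n + 1" using assms(2) by auto
  then obtain y ys where xs_eq: "xs = x # y # ys"
    by (auto simp: walk_betw_def length_Suc_conv)
  with xs have e: "{x, y} \<in> L" and w: "walk_betw V L y (y # ys) x0"
    by (auto simp: walk_betw_def walk_def)
  have "height y \<le> n" using gdist_le[OF w] xs xs_eq by simp
  moreover have "Suc n \<le> height y + 1" using height_edge[OF e] assms(2) by simp
  ultimately show ?thesis using e by auto
qed

text \<open>Passing repeatedly to a parent lowers the height at each step, so the walk misses every
  vertex other than \<open>x\<close> that is at least as high as \<open>x\<close>.\<close>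

lemma descending_walk:
  assumes "x \<in> V"
  shows "\<exists>xs. walk_betw V L x xs x0 \<and> (\<forall>v\<in>set xs. v = x \<or> height v < height x)"
  using assms
proof (induction "height x" arbitrary: x)
  case 0
  then have "x = x0" using gdist_eq_0 root by simp
  then show ?case using root by (intro exI[of _ "[x0]"]) (auto simp: walk_betw_def walk_def)
next
  case (Suc n)
  then obtain y where y: "{x, y} \<in> L" "height y = n" using height_parent by metis
  then have "y \<in> V" using edgeD by blast
  with Suc.hyps(1)[of y] y obtain ys where ys: "walk_betw V L y ys x0"
    "\<forall>v\<in>set ys. v = y \<or> height v < height y" by auto
  have "walk_betw V L x (x # ys) x0"
    using ys(1) y Suc.prems by (auto simp: walk_betw_def walk_def successively_Cons)
  moreover have "\<forall>v\<in>set (x # ys). v = x \<or> height v < height x"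
    using ys(2) y Suc.hyps(2) by auto
  ultimately show ?case by blast
qed

text \<open>Descending walks from two such neighbours meet at the root and avoid \<open>x\<close>, so together with
  \<open>x\<close> they would close a cycle.\<close>
lemma unique_lower_neighbour:
  assumes e: "{x, a} \<in> L" "{x, b} \<in> L" and le: "height a \<le> height x" "height b \<le> height x"
  shows "a = b"
proof (rule ccontr)
  assume ab: "a \<noteq> b"
  have V: "x \<in> V" "a \<in> V" "b \<in> V" "x \<noteq> a" "x \<noteq> b" using e edgeD by auto
  obtain as where as: "walk_betw V L a as x0" "\<forall>v\<in>set as. v = a \<or> height v < height a"
    using descending_walk[OF V(2)] by blast
  obtain bs where bs: "walk_betw V L b bs x0" "\<forall>v\<in>set bs. v = b \<or> height v < height b"
    using descending_walk[OF V(3)] by blast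
  have w: "walk_betw V L a (as @ tl (rev bs)) b"
    using walk_betw_append[OF as(1) walk_betw_rev[OF bs(1)]] .
  have "set (tl (rev bs)) \<subseteq> set bs" by (metis list.set_sel(2) set_rev subsetI list.sel(2))
  \<comment> \<open>Beyond their starting points both walks stay strictly below
    \<open>height x\<close>, and \<open>a\<close>, \<open>b\<close> themselves differ from
    \<open>x\<close> because edges are not loops.\<close>
  then have avoid: "x \<notin> set (as @ tl (rev bs))"
    using as(2) bs(2) le V by fastforce
  from walk_betw_distinct[OF w] obtain ys where ys: "walk_betw V L a ys b" "distinct ys"
    "x \<notin> set ys" using avoid by auto
  \<comment> \<open>With \<open>x\<close> added, this gives the three vertices that
    \<open>graph_cycle\<close> demands.\<close>
  then have "length ys \<ge> 2"
    using ab by (cases ys; cases "tl ys") (auto simp: walk_betw_def walk_def)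
  with ys have "graph_cycle V L (x # ys)"
    using e V by (auto simp: graph_cycle_def walk_betw_def walk_def successively_Cons insert_commute)
  then show False using tree by (auto simp: tree_def)
qed

lemma successors_eq:
  assumes "x \<in> V"
  shows "successors V L x0 x = {y. {x, y} \<in> L \<and> height y = Suc (height x)}"
  using assms gdist_eq_1 edgeD by (auto simp: successors_def sphere_at_def)

text \<open>A common successor would have two distinct lower neighbours.\<close>

lemma disjoint_successors:
  assumes "x \<in> V" "x' \<in> V" "x \<noteq> x'"
  shows "successors V L x0 x \<inter> successors V L x0 x' = {}"
proof -
  have False if "y \<in> successors V L x0 x" "y \<in> successors V L x0 x'" for y
    using that assms unique_lower_neighbour[of y x x'] by (simp add: successors_eq insert_commute)
  then show ?thesis by blast
qed

lemma sphere_Suc: "sphere_at V L x0 (Suc n) = (\<Union>x\<in>sphere_at V L x0 n. successors V L x0 x)"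
proof
  show "sphere_at V L x0 (Suc n) \<subseteq> (\<Union>x\<in>sphere_at V L x0 n. successors V L x0 x)"
  proof
    fix y assume y: "y \<in> sphere_at V L x0 (Suc n)"
    then obtain x where "{y, x} \<in> L" "height x = n"
      using height_parent by (auto simp: sphere_at_def)
    then show "y \<in> (\<Union>x\<in>sphere_at V L x0 n. successors V L x0 x)"
      using y edgeD by (intro UN_I[of x]) (auto simp: sphere_at_def successors_eq insert_commute)
  qed
qed (auto simp: successors_def sphere_at_def)

lemma ball_Suc: "ball_at V L x0 (Suc n) = ball_at V L x0 n \<union> sphere_at V L x0 (Suc n)"
  by (auto simp: ball_at_def sphere_at_def)

lemma ball_sphere_disjoint: "m < n \<Longrightarrow> ball_at V L x0 m \<inter> sphere_at V L x0 n = {}"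
  by (auto simp: ball_at_def sphere_at_def)

lemma successors_subset_ball:
  "x \<in> ball_at V L x0 n \<Longrightarrow> successors V L x0 x \<subseteq> ball_at V L x0 (Suc n)"
  by (auto simp: ball_at_def successors_def sphere_at_def)

text \<open>The removed vertex \<open>p\<close> is the parent. Every other neighbour lies strictly
  above \<open>x\<close>, since \<open>unique_lower_neighbour\<close> also rules out edges within a
  level, and \<open>height_edge\<close> then puts it exactly one level up.\<close>

lemma successors_eq_neighbours_minus:
  assumes "x \<in> V" "x \<noteq> x0"
  shows "\<exists>p. p \<in> neighbours V L x \<and> successors V L x0 x = neighbours V L x - {p}"
proof -
  have "height x \<noteq> 0" using assms gdist_eq_0 root by simp
  then obtain n where n: "height x = Suc n" using not0_implies_Suc by blast
  with assms height_parent obtain p where p: "{x, p} \<in> L" "height p = n" by blast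
  have "successors V L x0 x = neighbours V L x - {p}"
  proof (intro equalityI subsetI)
    fix y assume "y \<in> successors V L x0 x"
    then show "y \<in> neighbours V L x - {p}"
      using p n edgeD by (auto simp: successors_eq assms neighbours_def)
  next
    fix y assume y: "y \<in> neighbours V L x - {p}"
    then have "height y \<le> height x + 1" using height_edge[of y x] by (auto simp: neighbours_def insert_commute)
    moreover have "\<not> height y \<le> height x"
      using y p n unique_lower_neighbour[of x y p] by (auto simp: neighbours_def)
    ultimately show "y \<in> successors V L x0 x"
      using y by (auto simp: successors_eq assms neighbours_def)
  qed
  then show ?thesis using p edgeD by (auto simp: neighbours_def)
qed

end

section \<open>Finiteness of spheres and balls, and the number of successors\<close>

locale rooted_cayley_tree =
  fixes k :: nat and V :: "'v set" and L :: "'v set set" and x0 :: 'v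
  assumes cayley: "cayley_tree k V L" and root: "x0 \<in> V"

sublocale rooted_cayley_tree \<subseteq> rooted_tree
  using cayley root by unfold_locales (auto simp: cayley_tree_def)

context rooted_cayley_tree
begin

lemma finite_neighbours: "x \<in> V \<Longrightarrow> finite (neighbours V L x)"
  using cayley by (auto simp: cayley_tree_def intro!: card_ge_0_finite)

lemma finite_successors: "x \<in> V \<Longrightarrow> finite (successors V L x0 x)"
  by (rule finite_subset[OF _ finite_neighbours]) (auto simp: successors_eq neighbours_def dest: edgeD)

lemma finite_sphere: "finite (sphere_at V L x0 n)"
proof (induction n)
  case 0
  have "sphere_at V L x0 0 \<subseteq> {x0}" using gdist_eq_0 root by (auto simp: sphere_at_def)
  then show ?case using finite_subset by blast
next
  case (Suc n)
  then show ?case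
    unfolding sphere_Suc by (intro finite_UN_I finite_successors) (auto simp: sphere_at_def)
qed

lemma finite_ball: "finite (ball_at V L x0 n)"
proof (induction n)
  case 0
  have "ball_at V L x0 0 = sphere_at V L x0 0" by (auto simp: ball_at_def sphere_at_def)
  then show ?case using finite_sphere by simp
next
  case (Suc n)
  then show ?case by (simp add: ball_Suc finite_sphere)
qed

lemma card_successors:
  assumes "x \<in> V" "x \<noteq> x0" shows "card (successors V L x0 x) = k"
  using successors_eq_neighbours_minus[OF assms] cayley assms(1)
  by (auto simp: cayley_tree_def)

end

section \<open>Bounded measurable functions\<close>

text \<open>Unlike integrability, this property survives products and exponentials, and it implies
  integrability for every finite measure.\<close>

definition bounded_measurable :: "'a measure \<Rightarrow> ('a \<Rightarrow> real) \<Rightarrow> bool" where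
  "bounded_measurable M g \<longleftrightarrow> g \<in> borel_measurable M \<and> bounded (g ` space M)"

lemma bounded_measurable_on_iff:
  "bounded_measurable_on S g \<longleftrightarrow> bounded_measurable (restrict_space borel S) g"
  by (simp add: bounded_measurable_on_def bounded_measurable_def space_restrict_space)

lemma bounded_measurable_iff:
  "bounded_measurable M g \<longleftrightarrow> g \<in> borel_measurable M \<and> (\<exists>B. \<forall>x\<in>space M. \<bar>g x\<bar> \<le> B)"
  by (auto simp: bounded_measurable_def bounded_iff)

lemma bounded_measurable_const: "bounded_measurable M (\<lambda>x. c)"
  by (auto simp: bounded_measurable_iff)

lemma bounded_measurable_add:
  assumes "bounded_measurable M g" "bounded_measurable M k"
  shows "bounded_measurable M (\<lambda>x. g x + k x)"
proof -
  from assms obtain B C where "\<forall>x\<in>space M. \<bar>g x\<bar> \<le> B" "\<forall>x\<in>space M. \<bar>k x\<bar> \<le> C"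
    by (auto simp: bounded_measurable_iff)
  then have "\<forall>x\<in>space M. \<bar>g x + k x\<bar> \<le> B + C" by (fastforce intro: abs_triangle_ineq order_trans add_mono)
  with assms show ?thesis by (auto simp: bounded_measurable_iff)
qed

lemma bounded_measurable_mult:
  assumes "bounded_measurable M g" "bounded_measurable M k"
  shows "bounded_measurable M (\<lambda>x. g x * k x)"
proof -
  from assms obtain B C where "\<forall>x\<in>space M. \<bar>g x\<bar> \<le> B" "\<forall>x\<in>space M. \<bar>k x\<bar> \<le> C"
    by (auto simp: bounded_measurable_iff)
  then have "\<forall>x\<in>space M. \<bar>g x * k x\<bar> \<le> B * C"
    unfolding abs_mult by (meson abs_ge_zero mult_mono order_trans)
  with assms show ?thesis by (auto simp: bounded_measurable_iff)
qed

lemma bounded_measurable_sum: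
  "(\<And>i. i \<in> A \<Longrightarrow> bounded_measurable M (g i)) \<Longrightarrow> bounded_measurable M (\<lambda>x. \<Sum>i\<in>A. g i x)"
  by (induction A rule: infinite_finite_induct)
    (auto intro: bounded_measurable_const bounded_measurable_add)

lemma bounded_measurable_prod:
  "(\<And>i. i \<in> A \<Longrightarrow> bounded_measurable M (g i)) \<Longrightarrow> bounded_measurable M (\<lambda>x. \<Prod>i\<in>A. g i x)"
  by (induction A rule: infinite_finite_induct)
    (auto intro: bounded_measurable_const bounded_measurable_mult)

lemma bounded_measurable_exp:
  assumes "bounded_measurable M g" shows "bounded_measurable M (\<lambda>x. exp (g x))"
proof -
  from assms obtain B where "\<forall>x\<in>space M. \<bar>g x\<bar> \<le> B" by (auto simp: bounded_measurable_iff)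
  then have "\<forall>x\<in>space M. \<bar>exp (g x)\<bar> \<le> exp B" by (auto simp: abs_le_iff)
  with assms show ?thesis by (auto simp: bounded_measurable_iff)
qed

lemma bounded_measurable_compose:
  assumes "bounded_measurable N g" "T \<in> measurable M N"
  shows "bounded_measurable M (\<lambda>x. g (T x))"
  using assms measurable_space[OF assms(2)] measurable_compose[OF assms(2)]
  unfolding bounded_measurable_iff by blast

lemmas bounded_measurable_intros =
  bounded_measurable_const bounded_measurable_add bounded_measurable_mult
  bounded_measurable_sum bounded_measurable_prod bounded_measurable_exp

lemma (in finite_measure) bounded_measurable_integrable:
  assumes "bounded_measurable M g" shows "integrable M g"
proof -
  from assms obtain B where "\<forall>x\<in>space M. norm (g x) \<le> B" by (auto simp: bounded_measurable_iff)
  then show ?thesis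
    using assms by (intro integrable_const_bound[of g B]) (auto simp: bounded_measurable_iff)
qed

text \<open>A bound \<open>B\<close> on the exponent keeps the integrand above the positive constant
  \<open>exp (- B)\<close>.\<close>

lemma (in prob_space) integral_exp_pos:
  assumes "bounded_measurable M g" shows "0 < (\<integral>x. exp (g x) \<partial>M)"
proof -
  from assms obtain B where B: "\<forall>x\<in>space M. \<bar>g x\<bar> \<le> B" by (auto simp: bounded_measurable_iff)
  have "exp (- B) = (\<integral>x. exp (- B) \<partial>M)" by (simp add: prob_space)
  also have "\<dots> \<le> (\<integral>x. exp (g x) \<partial>M)"
    using B assms by (intro integral_mono bounded_measurable_integrable bounded_measurable_intros)
      (auto simp: abs_le_iff)
  finally show ?thesis using exp_gt_zero order_less_le_trans by blast
qed

section \<open>Integration over finite product spaces\<close>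

context product_prob_space
begin

lemma bounded_measurable_integrable_PiM:
  "bounded_measurable (Pi\<^sub>M A M) g \<Longrightarrow> integrable (Pi\<^sub>M A M) g"
  by (intro finite_measure.bounded_measurable_integrable prob_space.finite_measure
      prob_space_PiM prob_space) auto

lemma integral_PiM_pair:
  assumes "y \<noteq> z" and g: "bounded_measurable (Pi\<^sub>M {y, z} M) (\<lambda>\<omega>. g (\<omega> y) (\<omega> z))"
  shows "(\<integral>\<omega>. g (\<omega> y) (\<omega> z) \<partial>Pi\<^sub>M {y, z} M) = (\<integral>u. (\<integral>v. g u v \<partial>M z) \<partial>M y)"
proof -
  \<comment> \<open>Inserting \<open>z\<close> last makes its integral the inner one.\<close>
  have eq: "{y, z} = insert z {y}" by auto
  have [measurable]: "(\<lambda>\<omega>. g (\<omega> y) (\<omega> z)) \<in> borel_measurable (Pi\<^sub>M {y, z} M)"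
    using g by (simp add: bounded_measurable_def)
  \<comment> \<open>Composing with the map from pairs to configurations gives joint measurability of
    \<open>g\<close>, from which the inner integral is measurable in \<open>u\<close>.\<close>
  have "(\<lambda>p. \<lambda>i\<in>{y, z}. if i = y then fst p else snd p)
      \<in> measurable (M y \<Otimes>\<^sub>M M z) (Pi\<^sub>M {y, z} M)"
    using assms(1) by (intro measurable_restrict) auto
  from measurable_compose[OF this, of "\<lambda>\<omega>. g (\<omega> y) (\<omega> z)" borel]
  have "(\<lambda>(u, v). g u v) \<in> borel_measurable (M y \<Otimes>\<^sub>M M z)"
    using assms(1) by (simp add: case_prod_beta)
  then have meas: "(\<lambda>u. \<integral>v. g u v \<partial>M z) \<in> borel_measurable (M y)"
    by (intro M.borel_measurable_lebesgue_integral)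
  have "(\<integral>\<omega>. g (\<omega> y) (\<omega> z) \<partial>Pi\<^sub>M {y, z} M) = (\<integral>\<omega>. (\<integral>v. g (\<omega> y) v \<partial>M z) \<partial>Pi\<^sub>M {y} M)"
    using assms bounded_measurable_integrable_PiM[OF g] unfolding eq
    by (subst product_integral_insert) auto
  also have "\<dots> = (\<integral>u. (\<integral>v. g u v \<partial>M z) \<partial>M y)"
    using meas by (rule product_integral_singleton)
  finally show ?thesis .
qed

text \<open>Coordinates in disjoint blocks are independent, so Fubini splits off one block at a
  time. Points of the product over \<open>B x\<close> are extensional, which is why each factor
  receives a restriction of \<omega>.\<close>

lemma integral_PiM_prod_disjoint:
  assumes "finite A" "\<And>x. x \<in> A \<Longrightarrow> finite (B x)" "disjoint_family_on B A"
    and "\<And>x. x \<in> A \<Longrightarrow> bounded_measurable (Pi\<^sub>M (B x) M) (g x)"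
  shows "(\<integral>\<omega>. (\<Prod>x\<in>A. g x (restrict \<omega> (B x))) \<partial>Pi\<^sub>M (\<Union>x\<in>A. B x) M)
    = (\<Prod>x\<in>A. \<integral>\<omega>. g x \<omega> \<partial>Pi\<^sub>M (B x) M)"
  using assms
proof (induction A rule: finite_induct)
  case empty
  then show ?case
    using prob_space.prob_space[OF prob_space_PiM[of "{}" M]] by (simp add: prob_space)
next
  case (insert a A)
  let ?U = "\<Union>x\<in>A. B x"
  have disj: "B a \<inter> ?U = {}"
    using insert.prems(2) insert.hyps(2) by (fastforce simp: disjoint_family_on_def)
  have fin: "finite ?U" "finite (B a)" using insert by auto
  have bm: "bounded_measurable (Pi\<^sub>M (\<Union>x\<in>insert a A. B x) M) (\<lambda>\<omega>. g x (restrict \<omega> (B x)))"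
    if "x \<in> insert a A" for x
    using insert.prems(3)[OF that]
    by (rule bounded_measurable_compose) (rule measurable_restrict_subset, use that in auto)
  have "(\<integral>\<omega>. (\<Prod>x\<in>insert a A. g x (restrict \<omega> (B x))) \<partial>Pi\<^sub>M (\<Union>x\<in>insert a A. B x) M)
      = (\<integral>\<sigma>. (\<integral>\<omega>. (\<Prod>x\<in>insert a A. g x (restrict (merge (B a) ?U (\<sigma>, \<omega>)) (B x)))
          \<partial>Pi\<^sub>M ?U M) \<partial>Pi\<^sub>M (B a) M)"
    using product_integral_fold[OF disj fin(2,1) bounded_measurable_integrable_PiM]
      bounded_measurable_prod[of "insert a A", OF bm] by simp
  also have "\<dots> = (\<integral>\<sigma>. (\<integral>\<omega>. g a \<sigma> * (\<Prod>x\<in>A. g x (restrict \<omega> (B x))) \<partial>Pi\<^sub>M ?U M) \<partial>Pi\<^sub>M (B a) M)"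
  proof (intro Bochner_Integration.integral_cong refl)
    fix \<sigma> \<omega> assume s: "\<sigma> \<in> space (Pi\<^sub>M (B a) M)"
    \<comment> \<open>Equality, and not just agreement on \<open>B a\<close>, holds because \<sigma>
      is extensional.\<close>
    have "restrict (merge (B a) ?U (\<sigma>, \<omega>)) (B a) = \<sigma>"
      using s by (auto simp: fun_eq_iff merge_def space_PiM PiE_def extensional_def)
    moreover have "restrict (merge (B a) ?U (\<sigma>, \<omega>)) (B x) = restrict \<omega> (B x)" if "x \<in> A" for x
      using that disj by (auto simp: fun_eq_iff merge_def restrict_def)
    ultimately show "(\<Prod>x\<in>insert a A. g x (restrict (merge (B a) ?U (\<sigma>, \<omega>)) (B x)))
        = g a \<sigma> * (\<Prod>x\<in>A. g x (restrict \<omega> (B x)))"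
      using insert.hyps by simp
  qed
  also have "\<dots> = (\<integral>\<sigma>. g a \<sigma> \<partial>Pi\<^sub>M (B a) M) * (\<integral>\<omega>. (\<Prod>x\<in>A. g x (restrict \<omega> (B x))) \<partial>Pi\<^sub>M ?U M)"
    by simp
  also have "(\<integral>\<omega>. (\<Prod>x\<in>A. g x (restrict \<omega> (B x))) \<partial>Pi\<^sub>M ?U M) = (\<Prod>x\<in>A. \<integral>\<omega>. g x \<omega> \<partial>Pi\<^sub>M (B x) M)"
    using insert by (intro insert.IH) (auto simp: disjoint_family_on_def)
  finally show ?case using insert.hyps by simp
qed

end

section \<open>The spin model\<close>

abbreviation unit_measure :: "real measure" where
  "unit_measure \<equiv> restrict_space lborel {0..1}"

lemma prob_space_unit_measure: "prob_space unit_measure"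
  by (rule prob_spaceI) (simp add: emeasure_restrict_space space_restrict_space)

interpretation unit_prod: product_prob_space "\<lambda>_ :: 'v. unit_measure" UNIV
proof -
  interpret prob_space unit_measure by (rule prob_space_unit_measure)
  show "product_prob_space (\<lambda>_ :: 'v. unit_measure)" by unfold_locales
qed

lemma space_unit_measure: "space unit_measure = {0..1}"
  by (simp add: space_restrict_space)

lemma unit_measurableD:
  assumes "a \<in> measurable M unit_measure"
  shows "a \<in> borel_measurable M" "\<And>w. w \<in> space M \<Longrightarrow> a w \<in> {0..1}"
  using assms measurable_space[OF assms]
  by (auto simp: measurable_restrict_space2_iff space_unit_measure)

lemma set_integral_unit: "(LINT u:{0..1}|lborel. g u) = (\<integral>u. g u \<partial>unit_measure)" for g :: "real \<Rightarrow> real"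
  by (simp add: set_lebesgue_integral_def integral_restrict_space)

lemma prob_space_spin: "prob_space (spin_measure A)"
  unfolding spin_measure_def by (intro prob_space_PiM prob_space_unit_measure)

lemma space_spin: "space (spin_measure A) = A \<rightarrow>\<^sub>E {0..1}"
  by (simp add: spin_measure_def space_PiM space_restrict_space)

locale interval_spin_model = rooted_cayley_tree 2 V L x0
  for V :: "'v set" and L :: "'v set set" and x0 :: 'v +
  fixes prec :: "'v \<Rightarrow> 'v rel"
    and \<xi>1 :: "real \<Rightarrow> real \<Rightarrow> real \<Rightarrow> real" and \<xi>2 \<xi>3 :: "real \<Rightarrow> real \<Rightarrow> real"
    and J3 J J1 \<alpha> \<beta> :: real and h :: "real \<Rightarrow> 'v \<Rightarrow> real"
  assumes prec: "\<And>x. x \<in> V \<Longrightarrow> strict_linear_order_on (successors V L x0 x) (prec x)"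
    and \<xi>1: "bounded_measurable_on ({0..1} \<times> {0..1} \<times> {0..1}) (\<lambda>(t, u, v). \<xi>1 t u v)"
    and \<xi>2: "bounded_measurable_on ({0..1} \<times> {0..1}) (\<lambda>(u, v). \<xi>2 u v)"
    and \<xi>3: "bounded_measurable_on ({0..1} \<times> {0..1}) (\<lambda>(t, u). \<xi>3 t u)"
    and h: "\<And>x. x \<in> V - {x0} \<Longrightarrow> bounded_measurable_on {0..1} (\<lambda>t. h t x)"
begin

abbreviation "vball \<equiv> ball_at V L x0"
abbreviation "vsphere \<equiv> sphere_at V L x0"
abbreviation "succs \<equiv> successors V L x0"
abbreviation "pairs \<equiv> succ_pairs V L x0 prec"
abbreviation "weight \<equiv> gibbs_weight V L x0 prec \<xi>1 \<xi>2 \<xi>3 J3 J J1 \<alpha> \<beta> h"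
abbreviation "Z \<equiv> partition_function V L x0 prec \<xi>1 \<xi>2 \<xi>3 J3 J J1 \<alpha> \<beta> h"
abbreviation "gdensity \<equiv> gibbs_density V L x0 prec \<xi>1 \<xi>2 \<xi>3 J3 J J1 \<alpha> \<beta> h"
abbreviation "K \<equiv> interaction_kernel \<xi>1 \<xi>2 \<xi>3 J3 J J1 \<alpha> \<beta>"

text \<open>\<open>the_elem\<close> is specified only where the set of ordered pairs is a singleton, that is, away
  from the root.\<close>
definition lower :: "'v \<Rightarrow> 'v" where "lower x = fst (the_elem (pairs x))"
definition upper :: "'v \<Rightarrow> 'v" where "upper x = snd (the_elem (pairs x))"

text \<open>Totality orders the two successors one way; irreflexivity and transitivity exclude the
  reverse and the diagonal pairs.\<close>

lemma lower_upper:
  assumes "x \<in> V" "x \<noteq> x0"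
  shows "succs x = {lower x, upper x}" "lower x \<noteq> upper x" "pairs x = {(lower x, upper x)}"
proof -
  obtain a b where ab: "succs x = {a, b}" "a \<noteq> b"
    using card_successors[OF assms] by (auto simp: card_2_iff)
  from prec[OF assms(1)] have ord: "trans (prec x)" "irrefl (prec x)" "total_on {a, b} (prec x)"
    by (auto simp: strict_linear_order_on_def ab)
  have "\<exists>y z. succs x = {y, z} \<and> y \<noteq> z \<and> (y, z) \<in> prec x"
    using ord(3) ab unfolding total_on_def by (metis insertCI insert_commute)
  then obtain y z where yz: "succs x = {y, z}" "y \<noteq> z" "(y, z) \<in> prec x" by blast
  have "pairs x = {(y, z)}"
    using yz ord(1,2) by (auto simp: succ_pairs_def irrefl_def dest: transD)
  then show "succs x = {lower x, upper x}" "lower x \<noteq> upper x" "pairs x = {(lower x, upper x)}"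
    using yz by (simp_all add: lower_def upper_def)
qed

text \<open>Replaces the quantified successors of the integral equation by the functions
  \<open>lower\<close> and \<open>upper\<close>.\<close>

lemma ordered_successors_iff:
  assumes "x \<in> V" "x \<noteq> x0"
  shows "succs x = {y, z} \<and> (y, z) \<in> prec x \<longleftrightarrow> y = lower x \<and> z = upper x"
proof -
  have "pairs x = {(y, z)}" if "succs x = {y, z}" "(y, z) \<in> prec x"
  proof -
    from that have "(y, z) \<in> pairs x" by (auto simp: succ_pairs_def)
    then show ?thesis using lower_upper(3)[OF assms] by auto
  qed
  moreover have "(lower x, upper x) \<in> prec x"
    using lower_upper(3)[OF assms] by (auto simp: succ_pairs_def)
  ultimately show ?thesis using lower_upper[OF assms] by auto
qed

lemma sphereD: "x \<in> vsphere n \<Longrightarrow> 0 < n \<Longrightarrow> x \<in> V - {x0}"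
  using gdist_eq_0[OF root root] by (auto simp: sphere_at_def)

section \<open>Factorisation of the weight over the outermost generation\<close>

lemma sum_sphere_Suc: "(\<Sum>y\<in>vsphere (Suc n). g y) = (\<Sum>x\<in>vsphere n. \<Sum>y\<in>succs x. g y)"
proof -
  have "x \<in> V" if "x \<in> vsphere n" for x using that by (simp add: sphere_at_def)
  then show ?thesis
    unfolding sphere_Suc
    by (intro sum.UNION_disjoint finite_sphere ballI impI finite_successors disjoint_successors)
qed

text \<open>The contribution of the two successors of \<open>x\<close> when they form part of the
  boundary. It carries \<open>exp h\<close> in place of \<open>f\<close>, as the Gibbs weight
  does.\<close>

definition vertex_factor :: "'v \<Rightarrow> real \<Rightarrow> real \<Rightarrow> real \<Rightarrow> real" where
  "vertex_factor x t u v = K t u v * exp (h u (lower x)) * exp (h v (upper x))"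

text \<open>The prefactor cancels the boundary field at \<open>x\<close>: it is present in the
  weight on the ball ending at \<open>x\<close>, but absent once \<open>x\<close> has become
  interior.\<close>

definition cavity :: "'v \<Rightarrow> real \<Rightarrow> real" where
  "cavity x t = exp (- h t x) * (\<integral>u. (\<integral>v. vertex_factor x t u v \<partial>unit_measure) \<partial>unit_measure)"

lemma weight_Suc:
  assumes "0 < n"
  shows "weight (Suc n) \<sigma> = weight n \<sigma> *
    (\<Prod>x\<in>vsphere n. exp (- h (\<sigma> x) x) * vertex_factor x (\<sigma> x) (\<sigma> (lower x)) (\<sigma> (upper x)))"
proof -
  from assms obtain m where m: "n = Suc m" by (cases n) auto
  \<comment> \<open>The interaction exponent at \<open>x\<close>. The external field is kept apart
    because its sum runs over the whole ball, whereas the interactions sum over the ball one step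
    smaller.\<close>
  define E where "E x = J3 * \<beta> * (\<Sum>(y, z)\<in>pairs x. \<xi>1 (\<sigma> x) (\<sigma> y) (\<sigma> z))
      + J * \<beta> * (\<Sum>(y, z)\<in>pairs x. \<xi>2 (\<sigma> y) (\<sigma> z))
      + J1 * \<beta> * (\<Sum>y\<in>succs x. \<xi>3 (\<sigma> x) (\<sigma> y))" for x
  have weight: "weight (Suc k) \<sigma> = exp ((\<Sum>x\<in>vball k. E x) + \<alpha> * \<beta> * (\<Sum>x\<in>vball (Suc k). \<sigma> x)
      + (\<Sum>x\<in>vsphere (Suc k). h (\<sigma> x) x))" for k
    by (simp add: gibbs_weight_def hamiltonian_def E_def sum.distrib sum_distrib_left[symmetric])
      (simp add: algebra_simps)
  have split: "(\<Sum>x\<in>vball (Suc k). g x) = (\<Sum>x\<in>vball k. g x) + (\<Sum>x\<in>vsphere (Suc k). g x)"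
    for k and g :: "'v \<Rightarrow> real"
    unfolding ball_Suc
    by (rule sum.union_disjoint) (auto simp: finite_ball finite_sphere ball_sphere_disjoint)
  \<comment> \<open>Since \<open>0 < n\<close>, the root is not on this sphere, so each sum over
    pairs has a single term and matches the kernel \<open>K\<close>.\<close>
  have factor: "exp (- h (\<sigma> x) x) * vertex_factor x (\<sigma> x) (\<sigma> (lower x)) (\<sigma> (upper x))
      = exp (E x + \<alpha> * \<beta> * (\<Sum>y\<in>succs x. \<sigma> y) + (\<Sum>y\<in>succs x. h (\<sigma> y) y) - h (\<sigma> x) x)"
    if "x \<in> vsphere n" for x
  proof -
    have "x \<in> V" "x \<noteq> x0" using sphereD[OF that assms] by auto
    note lu = lower_upper[OF this]
    show ?thesis
      using lu(2) by (simp add: E_def vertex_factor_def interaction_kernel_def lu(3) lu(1)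
          exp_add[symmetric] algebra_simps)
  qed
  have "(\<Prod>x\<in>vsphere n. exp (- h (\<sigma> x) x) * vertex_factor x (\<sigma> x) (\<sigma> (lower x)) (\<sigma> (upper x)))
      = exp (\<Sum>x\<in>vsphere n. E x + \<alpha> * \<beta> * (\<Sum>y\<in>succs x. \<sigma> y) + (\<Sum>y\<in>succs x. h (\<sigma> y) y) - h (\<sigma> x) x)"
    by (simp add: exp_sum finite_sphere factor)
  also have "\<dots> = exp ((\<Sum>x\<in>vsphere n. E x) + \<alpha> * \<beta> * (\<Sum>y\<in>vsphere (Suc n). \<sigma> y)
      + (\<Sum>y\<in>vsphere (Suc n). h (\<sigma> y) y) - (\<Sum>x\<in>vsphere n. h (\<sigma> x) x))"
    by (simp add: sum_sphere_Suc sum.distrib sum_subtractf sum_distrib_left)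
  finally show ?thesis
    by (simp add: weight m split exp_add[symmetric] algebra_simps)
qed

text \<open>Needed to replace a merged configuration by its inner part. For \<open>n = 0\<close>
  truncated subtraction would let the Hamiltonian read successors of the root, outside the
  ball.\<close>

lemma weight_cong:
  assumes "0 < n" "\<And>x. x \<in> vball n \<Longrightarrow> \<sigma> x = \<tau> x"
  shows "weight n \<sigma> = weight n \<tau>"
proof -
  have vball: "\<sigma> x = \<tau> x" if "x \<in> vball (n - 1)" for x
    using that assms(2)[of x] by (auto simp: ball_at_def)
  have succ: "\<sigma> y = \<tau> y" if "x \<in> vball (n - 1)" "y \<in> succs x" for x y
    using successors_subset_ball[OF that(1)] that(2) assms by auto
  have vsphere: "\<sigma> x = \<tau> x" if "x \<in> vsphere n" for x
    using that assms(2)[of x] by (auto simp: ball_at_def sphere_at_def)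
  show ?thesis
    unfolding gibbs_weight_def hamiltonian_def
    by (intro arg_cong2[where f = "\<lambda>a b. exp (- \<beta> * a + b)"] arg_cong2[where f = "(-)"]
        arg_cong2[where f = "(*)"] sum.cong refl)
      (auto simp: vball succ vsphere assms(2) succ_pairs_def split: prod.splits intro!: sum.cong)
qed

section \<open>Boundedness and measurability of the weights\<close>

lemma bounded_measurable_\<xi>1:
  assumes "a \<in> measurable M unit_measure" "b \<in> measurable M unit_measure" "c \<in> measurable M unit_measure"
  shows "bounded_measurable M (\<lambda>w. \<xi>1 (a w) (b w) (c w))"
proof -
  note D = unit_measurableD[OF assms(1)] unit_measurableD[OF assms(2)] unit_measurableD[OF assms(3)]
  \<comment> \<open>The interaction is controlled only on the unit cube, so the substituted maps
    must take values there.\<close>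
  have "(\<lambda>w. (a w, b w, c w)) \<in> measurable M (restrict_space borel ({0..1} \<times> {0..1} \<times> {0..1}))"
    using D by (intro measurable_restrict_space2 borel_measurable_Pair) auto
  from bounded_measurable_compose[OF \<xi>1[unfolded bounded_measurable_on_iff] this]
  show ?thesis by simp
qed

lemma bounded_measurable_\<xi>23:
  assumes "a \<in> measurable M unit_measure" "b \<in> measurable M unit_measure"
  shows "bounded_measurable M (\<lambda>w. \<xi>2 (a w) (b w))" "bounded_measurable M (\<lambda>w. \<xi>3 (a w) (b w))"
proof -
  note D = unit_measurableD[OF assms(1)] unit_measurableD[OF assms(2)]
  have T: "(\<lambda>w. (a w, b w)) \<in> measurable M (restrict_space borel ({0..1} \<times> {0..1}))"
    using D by (intro measurable_restrict_space2 borel_measurable_Pair) auto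
  from bounded_measurable_compose[OF \<xi>2[unfolded bounded_measurable_on_iff] T]
    bounded_measurable_compose[OF \<xi>3[unfolded bounded_measurable_on_iff] T]
  show "bounded_measurable M (\<lambda>w. \<xi>2 (a w) (b w))" "bounded_measurable M (\<lambda>w. \<xi>3 (a w) (b w))"
    by simp_all
qed

lemma bounded_measurable_h:
  assumes "a \<in> measurable M unit_measure" "x \<in> V - {x0}"
  shows "bounded_measurable M (\<lambda>w. h (a w) x)"
proof -
  have "a \<in> measurable M (restrict_space borel {0..1})"
    using unit_measurableD[OF assms(1)] by (intro measurable_restrict_space2) auto
  from bounded_measurable_compose[OF h[OF assms(2), unfolded bounded_measurable_on_iff] this]
  show ?thesis .
qed

lemma bounded_measurable_id:
  assumes "a \<in> measurable M unit_measure" shows "bounded_measurable M a"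
  using unit_measurableD[OF assms] by (force simp: bounded_measurable_iff intro: exI[of _ 1])

lemmas spin_measurable_intros =
  bounded_measurable_\<xi>1 bounded_measurable_\<xi>23 bounded_measurable_h bounded_measurable_id

text \<open>A bounded exponent yields both the integrability of the weight and, by
  \<open>integral_exp_pos\<close>, a positive partition function.\<close>

lemma weight_eq_exp:
  assumes "0 < n"
  shows "\<exists>g. bounded_measurable (spin_measure (vball n)) g \<and> weight n = (\<lambda>\<sigma>. exp (g \<sigma>))"
proof -
  let ?M = "spin_measure (vball n)"
  have comp: "(\<lambda>\<sigma>. \<sigma> x) \<in> measurable ?M unit_measure" if "x \<in> vball n" for x
    unfolding spin_measure_def using that by (rule measurable_component_singleton)
  have sub: "x \<in> vball n" if "x \<in> vball (n - 1)" for x using that by (auto simp: ball_at_def)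
  have succ: "y \<in> vball n" if "x \<in> vball (n - 1)" "y \<in> succs x" for x y
    using successors_subset_ball[OF that(1)] that(2) assms by auto
  have vsphere: "x \<in> vball n" if "x \<in> vsphere n" for x using that by (auto simp: ball_at_def sphere_at_def)
  \<comment> \<open>Differences are written as sums with factor \<open>- 1\<close>, and pairs
    through \<open>fst\<close> and \<open>snd\<close>, so that the closure rules match
    syntactically.\<close>
  have "bounded_measurable ?M (\<lambda>\<sigma>.
      - \<beta> * (- J3 * (\<Sum>x\<in>vball (n - 1). \<Sum>p\<in>pairs x. \<xi>1 (\<sigma> x) (\<sigma> (fst p)) (\<sigma> (snd p)))
        + - 1 * (J * (\<Sum>x\<in>vball (n - 1). \<Sum>p\<in>pairs x. \<xi>2 (\<sigma> (fst p)) (\<sigma> (snd p))))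
        + - 1 * (J1 * (\<Sum>x\<in>vball (n - 1). \<Sum>y\<in>succs x. \<xi>3 (\<sigma> x) (\<sigma> y)))
        + - 1 * (\<alpha> * (\<Sum>x\<in>vball n. \<sigma> x)))
      + (\<Sum>x\<in>vsphere n. h (\<sigma> x) x))"
    by (intro bounded_measurable_intros spin_measurable_intros comp)
      (auto simp: succ_pairs_def assms intro: sub vsphere succ dest: sphereD)
  moreover have "weight n = (\<lambda>\<sigma>. exp (
      - \<beta> * (- J3 * (\<Sum>x\<in>vball (n - 1). \<Sum>p\<in>pairs x. \<xi>1 (\<sigma> x) (\<sigma> (fst p)) (\<sigma> (snd p)))
        + - 1 * (J * (\<Sum>x\<in>vball (n - 1). \<Sum>p\<in>pairs x. \<xi>2 (\<sigma> (fst p)) (\<sigma> (snd p))))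
        + - 1 * (J1 * (\<Sum>x\<in>vball (n - 1). \<Sum>y\<in>succs x. \<xi>3 (\<sigma> x) (\<sigma> y)))
        + - 1 * (\<alpha> * (\<Sum>x\<in>vball n. \<sigma> x)))
      + (\<Sum>x\<in>vsphere n. h (\<sigma> x) x)))"
    by (simp add: fun_eq_iff gibbs_weight_def hamiltonian_def case_prod_beta)
  ultimately show ?thesis by blast
qed

lemma Z_pos: "0 < n \<Longrightarrow> 0 < Z n"
  using weight_eq_exp[of n] prob_space.integral_exp_pos[OF prob_space_spin]
  by (auto simp: partition_function_def)

lemma vertex_factor_eq_exp:
  assumes "x \<in> V - {x0}" "t \<in> {0..1}"
  shows "\<exists>g. bounded_measurable (spin_measure (succs x)) g \<and>
    (\<lambda>\<omega>. vertex_factor x t (\<omega> (lower x)) (\<omega> (upper x))) = (\<lambda>\<omega>. exp (g \<omega>))"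
proof -
  have xV: "x \<in> V" "x \<noteq> x0" using assms by auto
  let ?M = "spin_measure (succs x)"
  have mem: "lower x \<in> succs x" "upper x \<in> succs x" using lower_upper[OF xV] by auto
  \<comment> \<open>Successors have positive height, hence are not the root, and the assumption on
    \<open>h\<close> applies to them.\<close>
  then have V: "lower x \<in> V - {x0}" "upper x \<in> V - {x0}"
    using sphereD[of _ "Suc (height x)"] by (auto simp: successors_def)
  have comp: "(\<lambda>\<sigma>. \<sigma> y) \<in> measurable ?M unit_measure" if "y \<in> succs x" for y
    unfolding spin_measure_def using that by (rule measurable_component_singleton)
  have const: "(\<lambda>\<sigma>. t) \<in> measurable ?M unit_measure"
    using assms(2) by (auto simp: space_unit_measure)
  have "bounded_measurable ?M (\<lambda>\<omega>. J3 * \<beta> * \<xi>1 t (\<omega> (lower x)) (\<omega> (upper x))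
      + J * \<beta> * \<xi>2 (\<omega> (lower x)) (\<omega> (upper x))
      + J1 * \<beta> * (\<xi>3 t (\<omega> (lower x)) + \<xi>3 t (\<omega> (upper x)))
      + \<alpha> * \<beta> * (\<omega> (lower x) + \<omega> (upper x)) + h (\<omega> (lower x)) (lower x) + h (\<omega> (upper x)) (upper x))"
    by (intro bounded_measurable_intros spin_measurable_intros comp const mem V)
  then show ?thesis
    by (intro exI conjI, assumption)
      (simp add: fun_eq_iff vertex_factor_def interaction_kernel_def exp_add[symmetric])
qed

section \<open>Integrating out the outer sphere\<close>

lemma integral_vertex_factor:
  assumes "x \<in> V - {x0}" "t \<in> {0..1}"
  shows "(\<integral>\<omega>. vertex_factor x t (\<omega> (lower x)) (\<omega> (upper x)) \<partial>spin_measure (succs x))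
      = (\<integral>u. (\<integral>v. vertex_factor x t u v \<partial>unit_measure) \<partial>unit_measure)"
proof -
  have xV: "x \<in> V" "x \<noteq> x0" using assms by auto
  note lu = lower_upper[OF xV]
  have "bounded_measurable (spin_measure (succs x))
      (\<lambda>\<omega>. vertex_factor x t (\<omega> (lower x)) (\<omega> (upper x)))"
    using vertex_factor_eq_exp[OF assms] bounded_measurable_exp by auto
  from unit_prod.integral_PiM_pair[OF lu(2) this[unfolded spin_measure_def lu(1)]]
  show ?thesis by (simp add: spin_measure_def lu(1))
qed

lemma cavity_pos:
  assumes "x \<in> V - {x0}" "t \<in> {0..1}"
  shows "0 < cavity x t"
  using vertex_factor_eq_exp[OF assms] prob_space.integral_exp_pos[OF prob_space_spin]
  by (fastforce simp: cavity_def integral_vertex_factor[OF assms, symmetric])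

text \<open>By \<open>weight_Suc\<close> the new spins enter through factors living on the disjoint
  successor sets, so the integral of their product is a product of cavities.\<close>

lemma integral_weight_Suc:
  assumes n: "0 < n" and \<sigma>: "\<sigma> \<in> vball n \<rightarrow>\<^sub>E {0..1}"
  shows "(\<integral>\<omega>. weight (Suc n) (merge (vball n) (vsphere (Suc n)) (\<sigma>, \<omega>)) \<partial>spin_measure (vsphere (Suc n)))
    = weight n \<sigma> * (\<Prod>x\<in>vsphere n. cavity x (\<sigma> x))"
proof -
  let ?m = "\<lambda>\<omega>. merge (vball n) (vsphere (Suc n)) (\<sigma>, \<omega>)"
  let ?g = "\<lambda>x \<omega>. exp (- h (\<sigma> x) x) * vertex_factor x (\<sigma> x) (\<omega> (lower x)) (\<omega> (upper x))"
  have mem: "x \<in> vball n" "x \<in> V - {x0}" "\<sigma> x \<in> {0..1}" if "x \<in> vsphere n" for x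
    using that sphereD[OF that n] \<sigma> by (auto simp: sphere_at_def ball_at_def PiE_def)
  have lu: "lower x \<in> succs x" "upper x \<in> succs x" if "x \<in> vsphere n" for x
    using lower_upper[of x] mem[OF that] by auto
  have old: "?m \<omega> x = \<sigma> x" if "x \<in> vball n" for x \<omega> using that by (simp add: merge_def)
  \<comment> \<open>\<open>merge\<close> prefers its first component, so \<omega> is read only
    because the sphere is disjoint from the ball.\<close>
  have new: "?m \<omega> y = \<omega> y" if "y \<in> succs x" "x \<in> vsphere n" for x y \<omega>
    using that ball_sphere_disjoint[of n "Suc n"] by (auto simp: merge_def sphere_Suc)
  have new_lu: "?m \<omega> (lower x) = \<omega> (lower x)" "?m \<omega> (upper x) = \<omega> (upper x)"
    if "x \<in> vsphere n" for x \<omega>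
    using new lu that by blast+
  have weight: "weight (Suc n) (?m \<omega>) = weight n \<sigma> * (\<Prod>x\<in>vsphere n. ?g x (restrict \<omega> (succs x)))" for \<omega>
    unfolding weight_Suc[OF n]
    by (intro arg_cong2[where f = "(*)"] weight_cong[OF n] prod.cong refl)
      (simp_all add: old mem(1) new_lu lu)
  have bm: "bounded_measurable (spin_measure (succs x)) (?g x)" if "x \<in> vsphere n" for x
    using vertex_factor_eq_exp[OF mem(2,3)[OF that]]
    by (auto intro!: bounded_measurable_intros)
  have "(\<integral>\<omega>. weight (Suc n) (?m \<omega>) \<partial>spin_measure (vsphere (Suc n)))
      = weight n \<sigma> * (\<integral>\<omega>. (\<Prod>x\<in>vsphere n. ?g x (restrict \<omega> (succs x))) \<partial>spin_measure (vsphere (Suc n)))"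
    by (simp only: weight Bochner_Integration.integral_mult_right_zero)
  also have "(\<integral>\<omega>. (\<Prod>x\<in>vsphere n. ?g x (restrict \<omega> (succs x))) \<partial>spin_measure (vsphere (Suc n)))
      = (\<Prod>x\<in>vsphere n. \<integral>\<omega>. ?g x \<omega> \<partial>spin_measure (succs x))"
    unfolding sphere_Suc spin_measure_def
  proof (rule unit_prod.integral_PiM_prod_disjoint)
    show "disjoint_family_on succs (vsphere n)"
      unfolding disjoint_family_on_def
      using disjoint_successors by (auto simp: sphere_at_def)
  qed (use mem bm in \<open>auto simp: finite_sphere spin_measure_def intro!: finite_successors\<close>)
  also have "\<dots> = (\<Prod>x\<in>vsphere n. cavity x (\<sigma> x))"
    by (intro prod.cong refl) (simp add: cavity_def integral_vertex_factor[OF mem(2,3)])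
  finally show ?thesis .
qed

text \<open>Fubini over the ball and the new sphere, with the inner integral given by
  \<open>integral_weight_Suc\<close>.\<close>

lemma Z_Suc:
  assumes "0 < n"
  shows "Z (Suc n) = (\<integral>\<sigma>. weight n \<sigma> * (\<Prod>x\<in>vsphere n. cavity x (\<sigma> x)) \<partial>spin_measure (vball n))"
proof -
  obtain g where "bounded_measurable (spin_measure (vball (Suc n))) g"
      "weight (Suc n) = (\<lambda>\<sigma>. exp (g \<sigma>))"
    using weight_eq_exp[of "Suc n"] by auto
  then have "integrable (Pi\<^sub>M (vball n \<union> vsphere (Suc n)) (\<lambda>_. unit_measure)) (weight (Suc n))"
    using bounded_measurable_exp
    by (intro unit_prod.bounded_measurable_integrable_PiM) (auto simp: spin_measure_def ball_Suc)
  from unit_prod.product_integral_fold[OF ball_sphere_disjoint finite_ball finite_sphere this]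
  have "Z (Suc n) = (\<integral>\<sigma>. (\<integral>\<omega>. weight (Suc n) (merge (vball n) (vsphere (Suc n)) (\<sigma>, \<omega>))
      \<partial>spin_measure (vsphere (Suc n))) \<partial>spin_measure (vball n))"
    by (simp add: partition_function_def spin_measure_def ball_Suc)
  also have "\<dots> = (\<integral>\<sigma>. weight n \<sigma> * (\<Prod>x\<in>vsphere n. cavity x (\<sigma> x)) \<partial>spin_measure (vball n))"
    by (intro Bochner_Integration.integral_cong refl integral_weight_Suc[OF assms])
      (simp add: space_spin)
  finally show ?thesis .
qed

section \<open>Consistency as constancy of the cavities\<close>

lemma consistent_densities_iff:
  "consistent_densities V L x0 gdensity \<longleftrightarrow>
    (\<forall>n>0. \<forall>\<sigma>\<in>vball n \<rightarrow>\<^sub>E {0..1}. (\<Prod>x\<in>vsphere n. cavity x (\<sigma> x)) = Z (Suc n) / Z n)"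
proof -
  have "(\<integral>\<omega>. gdensity (Suc n) (merge (vball n) (vsphere (Suc n)) (\<sigma>, \<omega>)) \<partial>spin_measure (vsphere (Suc n)))
      = gdensity n \<sigma> \<longleftrightarrow> (\<Prod>x\<in>vsphere n. cavity x (\<sigma> x)) = Z (Suc n) / Z n"
    if "0 < n" "\<sigma> \<in> vball n \<rightarrow>\<^sub>E {0..1}" for n \<sigma>
  proof -
    \<comment> \<open>Positivity allows cancelling the weight of \<sigma> and both normalizing
      constants.\<close>
    have "0 < Z n" "0 < Z (Suc n)" "0 < weight n \<sigma>"
      using Z_pos that by (auto simp: gibbs_weight_def)
    then show ?thesis
      by (simp add: gibbs_density_def integral_weight_Suc[OF that] field_simps)
  qed
  moreover have "(\<forall>n\<ge>2. P n) \<longleftrightarrow> (\<forall>n>0. P (Suc n))" for P :: "nat \<Rightarrow> bool"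
  proof (intro iffI allI impI)
    fix n :: nat assume "\<forall>n>0. P (Suc n)" "n \<ge> 2"
    then show "P n" by (cases n) auto
  qed auto
  ultimately show ?thesis
    by (simp add: consistent_densities_def)
qed

lemma consistent_densities_iff_cavity_const:
  "consistent_densities V L x0 gdensity \<longleftrightarrow> (\<forall>x\<in>V - {x0}. \<forall>t\<in>{0..1}. cavity x t = cavity x 0)"
proof
  assume cons: "consistent_densities V L x0 gdensity"
  show "\<forall>x\<in>V - {x0}. \<forall>t\<in>{0..1}. cavity x t = cavity x 0"
  proof (intro ballI)
    fix x and t :: real assume x: "x \<in> V - {x0}" and t: "t \<in> {0..1}"
    define n where "n = height x"
    have n: "0 < n" "x \<in> vsphere n" "x \<in> vball n"
      using x gdist_eq_0 root by (auto simp: n_def sphere_at_def ball_at_def)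
    \<comment> \<open>The other vertices of the sphere, with spins frozen at 0; this product is
      positive and can be cancelled.\<close>
    let ?P = "\<Prod>y\<in>vsphere n - {x}. cavity y 0"
    have "0 < ?P" using sphereD n(1) by (intro prod_pos) (auto intro!: cavity_pos)
    have eq: "cavity x s * ?P = Z (Suc n) / Z n" if "s \<in> {0..1}" for s
    proof -
      let ?\<sigma> = "\<lambda>y\<in>vball n. if y = x then s else 0"
      have "?\<sigma> \<in> vball n \<rightarrow>\<^sub>E {0..1}" using that by auto
      with cons n(1) have "(\<Prod>y\<in>vsphere n. cavity y (?\<sigma> y)) = Z (Suc n) / Z n"
        unfolding consistent_densities_iff by blast
      moreover have "(\<Prod>y\<in>vsphere n. cavity y (?\<sigma> y)) = cavity x s * ?P"
        using n by (subst prod.remove[OF finite_sphere n(2)])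
          (auto simp: sphere_at_def ball_at_def intro!: prod.cong)
      ultimately show ?thesis by simp
    qed
    from eq[OF t] eq[of 0] \<open>0 < ?P\<close> show "cavity x t = cavity x 0"
      by (metis atLeastAtMost_iff less_irrefl mult_right_cancel order_refl zero_le_one)
  qed
next
  assume const: "\<forall>x\<in>V - {x0}. \<forall>t\<in>{0..1}. cavity x t = cavity x 0"
  show "consistent_densities V L x0 gdensity"
    unfolding consistent_densities_iff
  proof (intro allI impI ballI)
    fix n :: nat and \<sigma> :: "'v \<Rightarrow> real"
    assume n: "0 < n" and \<sigma>: "\<sigma> \<in> vball n \<rightarrow>\<^sub>E {0..1}"
    let ?C = "\<Prod>x\<in>vsphere n. cavity x 0"
    have C: "(\<Prod>x\<in>vsphere n. cavity x (\<tau> x)) = ?C" if "\<tau> \<in> vball n \<rightarrow>\<^sub>E {0..1}" for \<tau>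
    proof (intro prod.cong refl)
      fix x assume x: "x \<in> vsphere n"
      then have "\<tau> x \<in> {0..1}" using that by (auto simp: sphere_at_def ball_at_def PiE_def)
      then show "cavity x (\<tau> x) = cavity x 0" using const sphereD[OF x n] by blast
    qed
    \<comment> \<open>The product of cavities is the constant \<open>?C\<close> on all
      configurations, so it leaves the integral in \<open>Z_Suc\<close>.\<close>
    have "Z (Suc n) = (\<integral>\<tau>. weight n \<tau> * ?C \<partial>spin_measure (vball n))"
      unfolding Z_Suc[OF n] by (intro Bochner_Integration.integral_cong refl) (simp add: space_spin C)
    also have "\<dots> = Z n * ?C" by (simp add: partition_function_def)
    finally show "(\<Prod>x\<in>vsphere n. cavity x (\<sigma> x)) = Z (Suc n) / Z n"
      using Z_pos[OF n] C[OF \<sigma>] by simp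
  qed
qed

section \<open>From constant cavities to the integral equation\<close>

lemma integral_field_ratio:
  "(LINT u:{0..1}|lborel. LINT v:{0..1}|lborel.
      K t u v * field_ratio h u (lower x) * field_ratio h v (upper x))
    = cavity x t * exp (h t x) * exp (- h 0 (lower x) - h 0 (upper x))"
proof -
  \<comment> \<open>Normalizing the fields at spin 0 costs a factor independent of \<open>t\<close>,
    \<open>u\<close> and \<open>v\<close>.\<close>
  have "K t u v * field_ratio h u (lower x) * field_ratio h v (upper x)
      = vertex_factor x t u v * exp (- h 0 (lower x) - h 0 (upper x))" for u v
    by (simp add: field_ratio_def vertex_factor_def exp_diff exp_minus field_simps)
  then show ?thesis
    by (simp add: set_integral_unit cavity_def exp_minus)
qed

text \<open>By \<open>integral_field_ratio\<close> the quotient equals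
  \<open>field_ratio h t x * cavity x t / cavity x 0\<close>, because the normalizing factor at the
  successors cancels.\<close>

lemma cavity_const_iff:
  assumes "x \<in> V - {x0}" "t \<in> {0..1}"
  shows "cavity x t = cavity x 0 \<longleftrightarrow> field_ratio h t x =
    (LINT u:{0..1}|lborel. LINT v:{0..1}|lborel.
      K t u v * field_ratio h u (lower x) * field_ratio h v (upper x)) /
    (LINT u:{0..1}|lborel. LINT v:{0..1}|lborel.
      K 0 u v * field_ratio h u (lower x) * field_ratio h v (upper x))"
  unfolding integral_field_ratio using cavity_pos[OF assms(1), of 0]
  by (auto simp: field_ratio_def exp_diff field_simps)

end

theorem theorem3p2:
  fixes V :: "'v set" and L :: "'v set set" and x0 :: 'v and prec :: "'v \<Rightarrow> 'v rel"
    and \<xi>1 :: "real \<Rightarrow> real \<Rightarrow> real \<Rightarrow> real" and \<xi>2 \<xi>3 :: "real \<Rightarrow> real \<Rightarrow> real"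
    and \<beta> J J1 J3 \<alpha> :: real and h :: "real \<Rightarrow> 'v \<Rightarrow> real"
  assumes "cayley_tree 2 V L" and "x0 \<in> V"
    and "\<And>x. x \<in> V \<Longrightarrow> strict_linear_order_on (successors V L x0 x) (prec x)"
    and "bounded_measurable_on ({0..1} \<times> {0..1} \<times> {0..1}) (\<lambda>(t, u, v). \<xi>1 t u v)"
    and "bounded_measurable_on ({0..1} \<times> {0..1}) (\<lambda>(u, v). \<xi>2 u v)"
    and "bounded_measurable_on ({0..1} \<times> {0..1}) (\<lambda>(t, u). \<xi>3 t u)"
    and "\<beta> > 0" and "J3\<^sup>2 + J1\<^sup>2 + J\<^sup>2 + \<alpha>\<^sup>2 \<noteq> 0"
    and "\<And>x. x \<in> V - {x0} \<Longrightarrow> bounded_measurable_on {0..1} (\<lambda>t. h t x)"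
  defines "f \<equiv> field_ratio h"
    and "K \<equiv> interaction_kernel \<xi>1 \<xi>2 \<xi>3 J3 J J1 \<alpha> \<beta>"
    and "\<mu> \<equiv> gibbs_density V L x0 prec \<xi>1 \<xi>2 \<xi>3 J3 J J1 \<alpha> \<beta> h"
  shows "consistent_densities V L x0 \<mu> \<longleftrightarrow>
    (\<forall>x \<in> V - {x0}. \<forall>y z. successors V L x0 x = {y, z} \<and> (y, z) \<in> prec x \<longrightarrow>
      (\<forall>t\<in>{0..1}. f t x =
         (LINT u:{0..1}|lborel. LINT v:{0..1}|lborel. K t u v * f u y * f v z) /
         (LINT u:{0..1}|lborel. LINT v:{0..1}|lborel. K 0 u v * f u y * f v z)))"
proof -
  interpret interval_spin_model V L x0 prec \<xi>1 \<xi>2 \<xi>3 J3 J J1 \<alpha> \<beta> h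
    using assms(1-6,9) by unfold_locales
  show ?thesis
    unfolding f_def K_def \<mu>_def consistent_densities_iff_cavity_const
    by (intro ball_cong refl) (auto simp: ordered_successors_iff cavity_const_iff)
qed

end
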